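(* Let $m$ be a positive integer, and set $M=R_4(2m-1)$, $\ell(m)=f(M,M,M)$ and $k(m)=n_M(R(m))$. If a graph $G$ contains a set $X\subseteq V(G)$ which distinguishes $\ell(m)$ sets, each of size $k(m)$, then $G$ contains $U^m_i$ as an induced subgraph for some $1\le i\le 24$.
   Context: Graphs are finite and simple. Distinguishing: for a graph $G$ and $X\subseteq V(G)$, pairwise disjoint subsets $U_1,\dots,U_p$ of $V(G)$ are distinguished by $X$ if for each $i$ all vertices of $U_i$ have the same neighbourhood in $X$, and for $i\ne j$ vertices $x\in U_i$, $y\in U_j$ have different neighbourhoods in $X$ ($X$ need not be disjoint from the $U_i$). Disjoint vertex sets $U,V$ are joined if all edges between them are present and co-joined if none is. Let $G$ be a graph with a partition $V(G)=X\cup V_1\cup\cdots\cup V_r$, $X=\{v_1,\dots,v_r\}$. $G$ is an $r$-star if each $v_i$ is joined to $V_i$ and co-joined to $V_j$ for $j\ne i$; an $r$-costar if each $v_i$ is co-joined to $V_i$ and joined to $V_j$ for $j\neq i$; an $r$-skewchain if each $v_i$ is joined to $V_j$ for $j\le i$ and co-joined to $V_j$ for $j>i$. When $|V_i|=1$ for all $i$ and $G$ is bipartite with one part equal to $X$, these are called an $r$-matching, an $r$-comatching and an $r$-halfgraph, respectively. $U^r_1,\dots,U^r_{24}$ denote (in some order) the $3\cdot2\cdot2\cdot2=24$ graphs on $r^2+r$ vertices that are an $r$-star, $r$-costar or $r$-skewchain with $|X|=|V_i|=r$ for all $i$, in which: $X$ is an independent set or a clique; either all $V_i$ are independent sets or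 all $V_i$ are cliques; and either all pairs $V_i,V_j$ ($i\ne j$) are joined or all such pairs are co-joined. Numbers: $R(n)$ is the Ramsey number such that every graph on $R(n)$ vertices contains a clique or independent set of size $n$; $R_4(k)=R(k,k,k,k)$ is the 4-colour Ramsey number; $f(p,q,r)$ is a number (which exists for all $p,q,r\in\mathbb{N}$) such that every bipartite graph in which one part has $f(p,q,r)$ vertices with pairwise distinct neighbourhoods contains a $p$-matching, a $q$-comatching or an $r$-halfgraph as an induced subgraph; $n_1(t)=t$ and $n_k(t)=2^{k-2}\,t\,2^{2^k t}$ for $k\ge 2$ (a number such that every graph partitioned into $k$ sets $V_1,\dots,V_k$, each with at least $n_k(t)$ vertices, has subsets $W_i\subseteq V_i$, $|W_i|\ge t$, with each pair $W_i,W_j$, $i\ne j$, joined or co-joined). *)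

theory Defs
  imports "HOL-Library.Ramsey" "HOL-Library.Disjoint_Sets"
begin

text \<open>
  A finite simple graph is a pair of a vertex set and an edge set, edges being two-element sets of
  vertices; cliques and independent sets are \<^const>\<open>clique\<close> and \<^const>\<open>indep\<close>.
\<close>

definition graph :: "'a set \<Rightarrow> 'a set set \<Rightarrow> bool" where
  "graph V E \<longleftrightarrow> finite V \<and> E \<subseteq> [V]\<^bsup>2\<^esup>"

definition bipartite :: "'a set \<Rightarrow> 'a set \<Rightarrow> 'a set set \<Rightarrow> bool" where
  "bipartite A B E \<longleftrightarrow> graph (A \<union> B) E \<and> A \<inter> B = {} \<and> indep A E \<and> indep B E"

definition nbhd :: "'a set set \<Rightarrow> 'a set \<Rightarrow> 'a \<Rightarrow> 'a set" where
  "nbhd E X u = {x \<in> X. {u, x} \<in> E}"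

definition distinguishes ::
  "'a set \<Rightarrow> 'a set set \<Rightarrow> 'a set \<Rightarrow> nat \<Rightarrow> (nat \<Rightarrow> 'a set) \<Rightarrow> bool" where
  "distinguishes V E X p U \<longleftrightarrow>
     X \<subseteq> V \<and> (\<forall>i\<in>{1..p}. U i \<subseteq> V) \<and> disjoint_family_on U {1..p} \<and>
     (\<forall>i\<in>{1..p}. \<forall>x\<in>U i. \<forall>y\<in>U i. nbhd E X x = nbhd E X y) \<and>
     (\<forall>i\<in>{1..p}. \<forall>j\<in>{1..p}. i \<noteq> j \<longrightarrow> (\<forall>x\<in>U i. \<forall>y\<in>U j. nbhd E X x \<noteq> nbhd E X y))"

definition joined :: "'a set set \<Rightarrow> 'a set \<Rightarrow> 'a set \<Rightarrow> bool" where
  "joined E A B \<longleftrightarrow> A \<inter> B = {} \<and> (\<forall>a\<in>A. \<forall>b\<in>B. {a, b} \<in> E)"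

definition cojoined :: "'a set set \<Rightarrow> 'a set \<Rightarrow> 'a set \<Rightarrow> bool" where
  "cojoined E A B \<longleftrightarrow> A \<inter> B = {} \<and> (\<forall>a\<in>A. \<forall>b\<in>B. {a, b} \<notin> E)"

text \<open>
  The graph has the partition \<open>V = X \<union> W 1 \<union> \<dots> \<union> W r\<close> with \<open>X = {v 1, \<dots>, v r}\<close> of size \<open>r\<close>.
\<close>

definition partitioned ::
  "nat \<Rightarrow> 'a set \<Rightarrow> 'a set set \<Rightarrow> (nat \<Rightarrow> 'a) \<Rightarrow> (nat \<Rightarrow> 'a set) \<Rightarrow> bool" where
  "partitioned r V E v W \<longleftrightarrow>
     graph V E \<and> V = v ` {1..r} \<union> (\<Union>i\<in>{1..r}. W i) \<and> inj_on v {1..r} \<and>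
     disjoint_family_on W {1..r} \<and> (\<forall>i\<in>{1..r}. v ` {1..r} \<inter> W i = {})"

datatype shape = Star | Costar | Skewchain

fun has_shape ::
  "shape \<Rightarrow> nat \<Rightarrow> 'a set \<Rightarrow> 'a set set \<Rightarrow> (nat \<Rightarrow> 'a) \<Rightarrow> (nat \<Rightarrow> 'a set) \<Rightarrow> bool" where
  "has_shape Star r V E v W \<longleftrightarrow> partitioned r V E v W \<and>
     (\<forall>i\<in>{1..r}. joined E {v i} (W i) \<and> (\<forall>j\<in>{1..r}. j \<noteq> i \<longrightarrow> cojoined E {v i} (W j)))"
| "has_shape Costar r V E v W \<longleftrightarrow> partitioned r V E v W \<and>
     (\<forall>i\<in>{1..r}. cojoined E {v i} (W i) \<and> (\<forall>j\<in>{1..r}. j \<noteq> i \<longrightarrow> joined E {v i} (W j)))"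
| "has_shape Skewchain r V E v W \<longleftrightarrow> partitioned r V E v W \<and>
     (\<forall>i\<in>{1..r}. \<forall>j\<in>{1..r}. (j \<le> i \<longrightarrow> joined E {v i} (W j)) \<and>
                             (j > i \<longrightarrow> cojoined E {v i} (W j)))"

text \<open>
  For \<^const>\<open>Star\<close>, \<^const>\<open>Costar\<close> and \<^const>\<open>Skewchain\<close> these are the \<open>r\<close>-matchings,
  \<open>r\<close>-comatchings and \<open>r\<close>-halfgraphs, respectively.
\<close>

definition bipartite_shape :: "shape \<Rightarrow> nat \<Rightarrow> 'a set \<Rightarrow> 'a set set \<Rightarrow> bool" where
  "bipartite_shape s r V E \<longleftrightarrow>
     (\<exists>v W. has_shape s r V E v W \<and> (\<forall>i\<in>{1..r}. card (W i) = 1) \<and>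
            bipartite (v ` {1..r}) (\<Union>i\<in>{1..r}. W i) E)"

abbreviation "matching \<equiv> bipartite_shape Star"
abbreviation "comatching \<equiv> bipartite_shape Costar"
abbreviation "halfgraph \<equiv> bipartite_shape Skewchain"

text \<open>
  The property \<open>H\<close> stands for an isomorphism class of graphs, so that no isomorphism has to be
  mentioned: some induced subgraph belongs to the class.
\<close>

definition contains_induced ::
  "'a set \<Rightarrow> 'a set set \<Rightarrow> ('a set \<Rightarrow> 'a set set \<Rightarrow> bool) \<Rightarrow> bool" where
  "contains_induced V E H \<longleftrightarrow> (\<exists>S\<subseteq>V. H S {e \<in> E. e \<subseteq> S})"

text \<open>
  The 24 graphs \<open>U\<^sup>r\<close> (each up to isomorphism) are indexed by the shape and three flags, telling whether
  \<open>X\<close> is a clique (or else independent), whether all parts \<open>V\<^sub>i\<close> are cliques (or else independent),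
  and whether all pairs of distinct parts are joined (or else co-joined).
\<close>

type_synonym U_index = "shape \<times> bool \<times> bool \<times> bool"

fun U_graph :: "U_index \<Rightarrow> nat \<Rightarrow> 'a set \<Rightarrow> 'a set set \<Rightarrow> bool" where
  "U_graph (s, xc, vc, jc) r V E \<longleftrightarrow>
     (\<exists>v W. has_shape s r V E v W \<and> (\<forall>i\<in>{1..r}. card (W i) = r) \<and>
        (if xc then clique (v ` {1..r}) E else indep (v ` {1..r}) E) \<and>
        (\<forall>i\<in>{1..r}. if vc then clique (W i) E else indep (W i) E) \<and>
        (\<forall>i\<in>{1..r}. \<forall>j\<in>{1..r}. i \<noteq> j \<longrightarrow>
           (if jc then joined E (W i) (W j) else cojoined E (W i) (W j))))"

lemma card_U_index: "card (UNIV :: U_index set) = 24"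
proof -
  have "(UNIV :: shape set) = {Star, Costar, Skewchain}"
    using shape.exhaust by auto
  then have "card (UNIV :: shape set) = 3"
    by (metis (no_types, lifting) card.empty card_insert_disjoint empty_iff finite.intros insert_iff
        numeral_3_eq_3 shape.distinct)
  then show ?thesis
    by (simp add: card_cartesian_product flip: UNIV_Times_UNIV)
qed

definition ramsey_number :: "nat \<Rightarrow> nat" where
  "ramsey_number n = (LEAST N. \<forall>E. graph {..<N} E \<longrightarrow>
     (\<exists>S\<subseteq>{..<N}. card S = n \<and> (clique S E \<or> indep S E)))"

definition ramsey4 :: "nat \<Rightarrow> nat" where
  "ramsey4 k = (LEAST N. partn_lst {..<N} [k, k, k, k] 2)"

text \<open>
  \<open>N\<close> has the property required of \<open>f(p,q,r)\<close>.  As graphs are finite, vertices can be taken in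
  \<^typ>\<open>nat\<close> without loss of generality.
\<close>

definition bipartite_forcing :: "nat \<Rightarrow> nat \<Rightarrow> nat \<Rightarrow> nat \<Rightarrow> bool" where
  "bipartite_forcing p q r N \<longleftrightarrow>
     (\<forall>(A :: nat set) B E.
        bipartite A B E \<and> card A = N \<and> inj_on (nbhd E (A \<union> B)) A \<longrightarrow>
        contains_induced (A \<union> B) E (matching p) \<or>
        contains_induced (A \<union> B) E (comatching q) \<or>
        contains_induced (A \<union> B) E (halfgraph r))"

text \<open>The number \<open>n\<^sub>k(t)\<close>, which is meaningful only for \<open>k \<ge> 1\<close>.\<close>

definition n_parts :: "nat \<Rightarrow> nat \<Rightarrow> nat" where
  "n_parts k t = (if k = 1 then t else 2 ^ (k - 2) * t * 2 ^ (2 ^ k * t))"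

end

theory Submission
  imports Defs
begin

text \<open>
  Choose a vertex \<open>u\<^sub>i\<close> in each \<open>U\<^sub>i\<close>.  The sets \<open>N(u\<^sub>i) \<inter> X\<close> are distinct, so in the bipartite graph with
  the \<open>u\<^sub>i\<close> on one side and a copy of \<open>X\<close> on the other the vertices \<open>u\<^sub>i\<close> have distinct neighbourhoods.
  A large matching, comatching or halfgraph in it gives \<open>M\<close> vertices \<open>x\<^sub>i \<in> X\<close> and \<open>M\<close> of the sets,
  such that \<open>x\<^sub>i\<close> is adjacent to all or to none of the \<open>j\<close>th set, as prescribed by a star, costar or
  skewchain (\<open>bipartite_forcing_pattern\<close>).  What remains is cleaning up
  (\<open>contains_U_graph_of_pattern\<close>): shrink the sets until every two are joined or co-joined
  (\<open>homogeneous_subsets\<close>); by Ramsey's theorem take in each of them a clique or independent set of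
  size \<open>m\<close>; colour a pair of indices \<open>i, j\<close> by whether \<open>x\<^sub>i\<close> and \<open>x\<^sub>j\<close> are adjacent and whether the \<open>i\<close>th and
  \<open>j\<close>th set are joined, and pass to \<open>2m - 1\<close> indices on which this four-colouring is constant; for
  \<open>m\<close> of them the sets are all cliques or all independent.  An increasing choice of indices
  preserves each of the three shapes.

  Two points need care.  First, \<open>X\<close> may meet the \<open>U\<^sub>i\<close>, while in a graph \<open>U\<^sup>m\<close> the set \<open>X\<close> and the
  parts are disjoint.  In a complete multipartite graph with a transversal as \<open>X\<close>, for instance,
  every \<open>U\<^sub>i\<close> contains a vertex of \<open>X\<close>.  The \<open>M\<close> vertices \<open>x\<^sub>i\<close> are therefore deleted from
  all sets beforehand; the number \<open>n\<^sub>M\<close> is more than twice what the shrinking argument consumes, so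
  enough vertices are left (\<open>n_parts_slack\<close>).  Secondly, a bipartite shape found as an abstract
  induced subgraph need not have its side \<open>X\<close> inside the copy of \<open>X\<close>.  It can be turned around as
  soon as \<open>M \<ge> 3\<close> (\<open>bipartite_shape_oriented\<close>), which holds for \<open>m \<ge> 2\<close>; for \<open>m = 1\<close> any two
  distinct vertices already induce one of the graphs \<open>U\<^sup>1\<close>.
\<close>

section \<open>Adjacency patterns of stars, costars and skewchains\<close>

definition pattern :: "shape \<Rightarrow> nat \<Rightarrow> nat \<Rightarrow> bool" where
  "pattern s i j = (case s of Star \<Rightarrow> i = j | Costar \<Rightarrow> i \<noteq> j | Skewchain \<Rightarrow> j \<le> i)"

text \<open>
  In all three shapes every \<open>v i\<close> is joined or co-joined to every part, so a shape amounts to a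
  relation between indices.  This treats the three shapes uniformly.
\<close>

lemma has_shape_iff_pattern:
  "has_shape s r V E v W \<longleftrightarrow> partitioned r V E v W \<and>
     (\<forall>i\<in>{1..r}. \<forall>j\<in>{1..r}. \<forall>w\<in>W j. {v i, w} \<in> E \<longleftrightarrow> pattern s i j)"
proof (cases "partitioned r V E v W")
  case True
  have "joined E {v i} (W j) \<longleftrightarrow> (\<forall>w\<in>W j. {v i, w} \<in> E)"
    "cojoined E {v i} (W j) \<longleftrightarrow> (\<forall>w\<in>W j. {v i, w} \<notin> E)" if "i \<in> {1..r}" "j \<in> {1..r}" for i j
  proof -
    have "v i \<notin> W j"
      using True that unfolding partitioned_def by blast
    then show "joined E {v i} (W j) \<longleftrightarrow> (\<forall>w\<in>W j. {v i, w} \<in> E)"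
      "cojoined E {v i} (W j) \<longleftrightarrow> (\<forall>w\<in>W j. {v i, w} \<notin> E)"
      by (auto simp: joined_def cojoined_def)
  qed
  with True show ?thesis
    by (cases s) (auto simp: pattern_def simp del: atLeastAtMost_iff, (metis not_le)+)
next
  case False
  then show ?thesis
    by (cases s) simp_all
qed

text \<open>
  The patterns refer only to equality and order of indices; hence a shape is inherited by every
  subset of the indices, enumerated in increasing order.
\<close>

lemma pattern_strict_mono:
  assumes "strict_mono_on I e" "i \<in> I" "j \<in> I"
  shows "pattern s (e i) (e j) \<longleftrightarrow> pattern s i j"
  using assms by (cases s) (simp_all add: pattern_def strict_mono_on_less_eq strict_mono_on_eq)

section \<open>Subsets that are pairwise joined or co-joined\<close>

lemma pigeonhole_constant_subset:
  assumes "finite A" "finite B" "f ` A \<subseteq> B" "B \<noteq> {}" "n * card B \<le> card A"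
  shows "\<exists>A'\<subseteq>A. n \<le> card A' \<and> (\<forall>x\<in>A'. \<forall>y\<in>A'. f x = f y)"
proof -
  obtain y where y: "y \<in> B" "card A \<le> card (f -` {y} \<inter> A) * card B"
    using pigeonhole_card[of f A B] assms by (auto simp: mult.commute)
  have "card B > 0"
    using assms by (simp add: card_gt_0_iff)
  with y(2) assms(5) have "n \<le> card (f -` {y} \<inter> A)"
    by (meson le_trans mult_le_cancel2)
  then show ?thesis
    by (intro exI[of _ "f -` {y} \<inter> A"]) auto
qed

lemma joined_commute: "joined E A B \<longleftrightarrow> joined E B A"
  unfolding joined_def by (metis Int_commute insert_commute)

lemma cojoined_commute: "cojoined E A B \<longleftrightarrow> cojoined E B A"
  unfolding cojoined_def by (metis Int_commute insert_commute)

text \<open>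
  One part \<open>U i\<close> is settled at a time.  Fix \<open>2\<^sup>k t\<close> vertices of it, where \<open>k\<close> is the number of the
  other parts, and restrict each other part to vertices with the same neighbourhood among them; this
  costs a factor of 2 to the power \<open>2\<^sup>k t\<close>.  After the other parts have been shrunk by induction, each
  of the fixed vertices is joined or co-joined to each of them, and \<open>t\<close> of the fixed vertices behave
  alike towards all \<open>k\<close> parts.  The exponents add up as \<open>(2 + 4 + \<dots> + 2\<^sup>k) t = (2 * 2\<^sup>k - 2) t\<close>,
  which gives the bound for \<open>k + 1\<close> parts.
\<close>

lemma homogeneous_subsets:
  assumes "finite I" "disjoint_family_on U I"
    and "\<And>i. i \<in> I \<Longrightarrow> finite (U i)"
    and "\<And>i. i \<in> I \<Longrightarrow> t * 2 ^ ((2 ^ card I - 2) * t) \<le> card (U i)"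
  shows "\<exists>W. \<forall>i\<in>I. W i \<subseteq> U i \<and> t \<le> card (W i) \<and>
    (\<forall>j\<in>I. i \<noteq> j \<longrightarrow> joined E (W i) (W j) \<or> cojoined E (W i) (W j))"
  using assms
proof (induction I arbitrary: U rule: finite_induct)
  case empty
  then show ?case
    by simp
next
  case (insert i J)
  define k where "k = card J"
  define s where "s = 2 ^ k * t"
  have card_ins: "card (insert i J) = Suc k"
    using insert.hyps by (simp add: k_def)
  have "t * 2 ^ k \<le> t * 2 ^ ((2 ^ Suc k - 2) * t)"
  proof (cases "t = 0")
    case False
    have "Suc k \<le> 2 ^ k"
      using less_exp[of k] by (simp add: Suc_le_eq)
    then have "k \<le> 2 ^ Suc k - 2"
      by simp
    also have "\<dots> \<le> (2 ^ Suc k - 2) * t"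
      using False by simp
    finally have "(2::nat) ^ k \<le> 2 ^ ((2 ^ Suc k - 2) * t)"
      by (intro power_increasing) auto
    then show ?thesis
      by (rule mult_le_mono2)
  qed simp
  also have "\<dots> \<le> card (U i)"
    using insert.prems(3)[of i] by (simp only: card_ins) simp
  finally have "s \<le> card (U i)"
    by (simp add: s_def mult.commute)
  then obtain A where A: "A \<subseteq> U i" "card A = s" "finite A"
    by (meson obtain_subset_with_card_n)
  have "\<exists>C\<subseteq>U j. t * 2 ^ ((2 ^ card J - 2) * t) \<le> card C \<and>
      (\<forall>x\<in>C. \<forall>y\<in>C. nbhd E A x = nbhd E A y)" if "j \<in> J" for j
  proof (rule pigeonhole_constant_subset)
    show "finite (U j)"
      using insert.prems(2) that by blast
    show "finite (Pow A)"
      using A by simp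
    have "k \<ge> 1"
      using that insert.hyps by (auto simp: k_def Suc_le_eq card_gt_0_iff)
    then have "(2::nat) ^ 1 \<le> 2 ^ k"
      by (intro power_increasing) auto
    then have "(2::nat) ^ k - 2 + 2 ^ k = 2 ^ Suc k - 2"
      by simp
    then have "(2 ^ k - 2) * t + s = (2 ^ Suc k - 2) * t"
      by (metis s_def distrib_right)
    then have "t * 2 ^ ((2 ^ card J - 2) * t) * card (Pow A) = t * 2 ^ ((2 ^ card (insert i J) - 2) * t)"
      using A by (simp add: card_ins card_Pow flip: k_def power_add)
    moreover have "t * 2 ^ ((2 ^ card (insert i J) - 2) * t) \<le> card (U j)"
      using that by (intro insert.prems(3)) simp
    ultimately show "t * 2 ^ ((2 ^ card J - 2) * t) * card (Pow A) \<le> card (U j)"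
      by (simp only:)
  qed (auto simp: nbhd_def)
  then obtain C where C: "\<And>j. j \<in> J \<Longrightarrow> C j \<subseteq> U j"
      "\<And>j. j \<in> J \<Longrightarrow> t * 2 ^ ((2 ^ card J - 2) * t) \<le> card (C j)"
      "\<And>j x y. j \<in> J \<Longrightarrow> x \<in> C j \<Longrightarrow> y \<in> C j \<Longrightarrow> nbhd E A x = nbhd E A y"
    by metis
  have "disjoint_family_on C J"
    using insert.prems(1) C(1) unfolding disjoint_family_on_def by blast
  moreover have "finite (C j)" if "j \<in> J" for j
    using C(1)[OF that] insert.prems(2)[of j] that finite_subset by blast
  ultimately obtain W where W: "\<And>j. j \<in> J \<Longrightarrow> W j \<subseteq> C j" "\<And>j. j \<in> J \<Longrightarrow> t \<le> card (W j)"
      "\<And>j j'. j \<in> J \<Longrightarrow> j' \<in> J \<Longrightarrow> j \<noteq> j' \<Longrightarrow>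
        joined E (W j) (W j') \<or> cojoined E (W j) (W j')"
    using insert.IH[of C] C(2) by blast
  \<comment> \<open>Vertices of \<open>C j\<close> cannot be told apart by \<open>a \<in> A\<close>, so \<open>g a\<close> describes \<open>a\<close> completely.\<close>
  define g where "g a = {j \<in> J. \<exists>c\<in>C j. {c, a} \<in> E}" for a
  have "\<exists>A'\<subseteq>A. t \<le> card A' \<and> (\<forall>x\<in>A'. \<forall>y\<in>A'. g x = g y)"
    by (rule pigeonhole_constant_subset[where B = "Pow J"])
      (use A insert.hyps in \<open>auto simp: g_def card_Pow s_def k_def mult.commute\<close>)
  then obtain A' where A': "A' \<subseteq> A" "t \<le> card A'" "\<And>x y. x \<in> A' \<Longrightarrow> y \<in> A' \<Longrightarrow> g x = g y"
    by blast
  have disj: "A' \<inter> W j = {}" if "j \<in> J" for j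
  proof -
    have "U i \<inter> U j = {}"
      using insert.prems(1) insert.hyps that unfolding disjoint_family_on_def by auto
    then show ?thesis
      using A'(1) A(1) W(1)[OF that] C(1)[OF that] by blast
  qed
  have adj: "{a, c} \<in> E \<longleftrightarrow> j \<in> g a" if "j \<in> J" "c \<in> W j" "a \<in> A'" for j c a
  proof -
    have "{c, a} \<in> E \<longleftrightarrow> {c', a} \<in> E" if "c' \<in> C j" for c'
      using C(3)[of j c c'] W(1)[of j] that \<open>j \<in> J\<close> \<open>c \<in> W j\<close> \<open>a \<in> A'\<close> A'(1)
      unfolding nbhd_def by blast
    then show ?thesis
      using that W(1)[of j] unfolding g_def by (auto simp: insert_commute)
  qed
  have hom: "joined E A' (W j) \<or> cojoined E A' (W j)" if "j \<in> J" for j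
  proof (cases "\<exists>a\<in>A'. j \<in> g a")
    case True
    with A'(3) have "\<forall>a\<in>A'. j \<in> g a"
      by blast
    then show ?thesis
      using adj[OF that] disj[OF that] by (auto simp: joined_def)
  next
    case False
    then show ?thesis
      using adj[OF that] disj[OF that] by (auto simp: cojoined_def)
  qed
  have hom': "joined E (W j) A' \<or> cojoined E (W j) A'" if "j \<in> J" for j
    using hom[OF that] joined_commute cojoined_commute by metis
  show ?case
  proof (intro exI[of _ "W(i := A')"] ballI)
    fix j assume "j \<in> insert i J"
    then show "(W(i := A')) j \<subseteq> U j \<and> t \<le> card ((W(i := A')) j) \<and>
      (\<forall>j'\<in>insert i J. j \<noteq> j' \<longrightarrow> joined E ((W(i := A')) j) ((W(i := A')) j') \<or>
         cojoined E ((W(i := A')) j) ((W(i := A')) j'))"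
      using W(1)[of j] C(1)[of j] W(2)[of j] W(3)[of j] hom hom' A(1) A'(1,2) insert.hyps
      by (cases "j = i") auto
  qed
qed

section \<open>The Ramsey numbers and the number \<open>n\<^sub>k(t)\<close>\<close>

lemma ramsey_number_subset:
  assumes "finite W" "ramsey_number m \<le> card W"
  shows "\<exists>S\<subseteq>W. card S = m \<and> (clique S E \<or> indep S E)"
proof -
  let ?P = "\<lambda>N. \<forall>F. graph {..<N} F \<longrightarrow> (\<exists>S\<subseteq>{..<N::nat}. card S = m \<and> (clique S F \<or> indep S F))"
  obtain r where r: "\<And>(V::nat set) F. finite V \<Longrightarrow> r \<le> card V \<Longrightarrow>
      \<exists>R\<subseteq>V. card R = m \<and> clique R F \<or> card R = m \<and> indep R F"
    using ramsey2[of m m] by metis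
  have "?P r"
  proof (intro allI impI)
    fix F :: "nat set set"
    show "\<exists>S\<subseteq>{..<r}. card S = m \<and> (clique S F \<or> indep S F)"
      using r[of "{..<r}" F] by auto
  qed
  then have R: "?P (ramsey_number m)"
    unfolding ramsey_number_def by (rule LeastI)
  obtain W' where W': "W' \<subseteq> W" "card W' = ramsey_number m" "finite W'"
    using assms(2) by (meson obtain_subset_with_card_n)
  then obtain h where h: "bij_betw h {..<ramsey_number m} W'"
    using ex_bij_betw_nat_finite[of W'] by (auto simp: lessThan_atLeast0)
  define F where "F = {e \<in> [{..<ramsey_number m}]\<^bsup>2\<^esup>. h ` e \<in> E}"
  have "graph {..<ramsey_number m} F"
    by (auto simp: graph_def F_def)
  with R obtain S where S: "S \<subseteq> {..<ramsey_number m}" "card S = m" "clique S F \<or> indep S F"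
    by blast
  have inj: "inj_on h S"
    using h S(1) by (meson bij_betw_def inj_on_subset)
  have "{h a, h b} \<in> E \<longleftrightarrow> {a, b} \<in> F" if "a \<in> S" "b \<in> S" "a \<noteq> b" for a b
    using that S(1) by (auto simp: F_def)
  then have "(clique S F \<longrightarrow> clique (h ` S) E) \<and> (indep S F \<longrightarrow> indep (h ` S) E)"
    by (fastforce simp: clique_def indep_def)
  then have "clique (h ` S) E \<or> indep (h ` S) E"
    using S(3) by blast
  moreover have "h ` S \<subseteq> W"
    using h S(1) W'(1) by (auto simp: bij_betw_def)
  ultimately show ?thesis
    using card_image[OF inj] S(2) by metis
qed

lemma ramsey_number_ge: "m \<le> ramsey_number m"
proof -
  obtain S where "S \<subseteq> {..<ramsey_number m}" "card S = m"
    using ramsey_number_subset[of "{..<ramsey_number m}" m "{}"] by auto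
  then show ?thesis
    by (metis card_lessThan card_mono finite_lessThan)
qed

text \<open>
  Four colours are the combinations of two independent binary choices, here \<open>P\<close> and \<open>Q\<close>.
\<close>

lemma ramsey4_homogeneous:
  fixes P Q :: "nat set \<Rightarrow> bool"
  obtains H p q where "H \<subseteq> {1..ramsey4 k}" "card H = k"
    "\<And>i j. i \<in> H \<Longrightarrow> j \<in> H \<Longrightarrow> i \<noteq> j \<Longrightarrow> (P {i, j} \<longleftrightarrow> p) \<and> (Q {i, j} \<longleftrightarrow> q)"
proof -
  \<comment> \<open>The truth values of \<open>P\<close> and \<open>Q\<close> are the two binary digits of the colour.\<close>
  define c :: "nat set \<Rightarrow> nat" where "c e = 2 * of_bool (P (Suc ` e)) + of_bool (Q (Suc ` e))" for e
  have "partn_lst {..<ramsey4 k} [k, k, k, k] 2"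
    unfolding ramsey4_def using ramsey_full by (rule LeastI_ex)
  moreover have "c \<in> [{..<ramsey4 k}]\<^bsup>2\<^esup> \<rightarrow> {..<4}"
    by (auto simp: c_def)
  ultimately obtain n H where n: "n < length [k, k, k, k]" and H: "H \<in> [{..<ramsey4 k}]\<^bsup>([k, k, k, k] ! n)\<^esup>"
    and mono: "c ` ([H]\<^bsup>2\<^esup>) \<subseteq> {n}"
    by (rule partn_lstE) simp
  have "[k, k, k, k] ! n = k"
    using n by (auto simp: less_Suc_eq numeral_eq_Suc)
  with H have H': "H \<subseteq> {..<ramsey4 k}" "card H = k"
    by (auto simp: nsets_def)
  show thesis
  proof
    show "Suc ` H \<subseteq> {1..ramsey4 k}"
      using H'(1) by auto
    show "card (Suc ` H) = k"
      using H'(2) by (simp add: card_image)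
    fix i j assume "i \<in> Suc ` H" "j \<in> Suc ` H" "i \<noteq> j"
    then obtain a b where ab: "i = Suc a" "j = Suc b" "{a, b} \<in> [H]\<^bsup>2\<^esup>"
      by auto
    then have "c {a, b} = n"
      using mono by blast
    then show "(P {i, j} \<longleftrightarrow> n \<ge> 2) \<and> (Q {i, j} \<longleftrightarrow> odd n)"
      using ab by (auto simp: c_def of_bool_def split: if_splits)
  qed
qed

lemma ramsey4_ge: "k \<le> ramsey4 k"
proof -
  obtain H where "H \<subseteq> {1..ramsey4 k}" "card H = k"
    using ramsey4_homogeneous by metis
  then show ?thesis
    by (metis card_atLeastAtMost card_mono diff_Suc_1 finite_atLeastAtMost)
qed

text \<open>
  The exponent in \<open>n\<^sub>k(t)\<close> exceeds the one needed for shrinking by \<open>2 t \<ge> 1\<close>.  So \<open>n\<^sub>k(t)\<close> is at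
  least twice the bound of \<open>homogeneous_subsets\<close>, and that bound itself is at least \<open>k\<close>.  Hence \<open>k\<close>
  vertices can be deleted from every part before shrinking.
\<close>

lemma n_parts_slack:
  assumes "2 \<le> k" "1 \<le> t"
  shows "t * 2 ^ ((2 ^ k - 2) * t) + k \<le> n_parts k t"
proof -
  define h where "h = t * 2 ^ ((2 ^ k - 2) * t)"
  have "k < 2 ^ k"
    by (rule less_exp)
  then have "k - 1 \<le> 2 ^ k - 2"
    by linarith
  also have "\<dots> \<le> (2 ^ k - 2) * t"
    using assms(2) by simp
  finally have "(2::nat) ^ (k - 1) \<le> 2 ^ ((2 ^ k - 2) * t)"
    by (intro power_increasing) auto
  also have "\<dots> \<le> h"
    using assms(2) by (simp add: h_def)
  finally have "k \<le> h"
    using less_exp[of "k - 1"] assms(1) by linarith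
  have "2 * t + (2 ^ k - 2) * t = 2 ^ k * t"
  proof -
    have "(2::nat) ^ 1 \<le> 2 ^ k"
      using assms(1) by (intro power_increasing) auto
    then have "2 + (2 ^ k - 2) = (2::nat) ^ k"
      by simp
    then show ?thesis
      by (metis distrib_right)
  qed
  then have "t * 2 ^ (2 ^ k * t) = 2 ^ (2 * t) * h"
    by (metis h_def mult.left_commute power_add)
  moreover have "(2::nat) ^ 1 \<le> 2 ^ (2 * t)"
    using assms(2) by (intro power_increasing) auto
  ultimately have "2 * h \<le> t * 2 ^ (2 ^ k * t)"
    by simp
  also have "\<dots> \<le> n_parts k t"
    using assms(1) by (simp add: n_parts_def)
  finally show ?thesis
    using \<open>k \<le> h\<close> by (simp add: h_def)
qed

section \<open>Matchings, comatchings and halfgraphs inside a bipartite graph\<close>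

lemma bipartite_edge_sides:
  assumes "bipartite A B E" "{x, y} \<in> E"
  shows "x \<in> A \<longleftrightarrow> y \<in> B" "x \<in> B \<longleftrightarrow> y \<in> A"
proof -
  have "x \<noteq> y" "x \<in> A \<union> B" "y \<in> A \<union> B" "A \<inter> B = {}"
    using assms by (auto simp: bipartite_def graph_def nsets_def card_insert_if split: if_splits)
  then show "x \<in> A \<longleftrightarrow> y \<in> B" "x \<in> B \<longleftrightarrow> y \<in> A"
    using assms unfolding bipartite_def indep_def by blast+
qed

text \<open>
  The abstract bipartition of the shape has to be compared with that of the host graph.
  A comatching with at least three vertices on each side and a halfgraph are connected, so their
  sides agree with those of the host up to exchange; exchanging the sides yields the same pattern
  when the order of the indices is reversed.  In a matching, each edge can be turned around
  separately.  The comatching with two vertices on each side is disconnected, and with one vertex on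
  each side it may lie inside \<open>A\<close>; this is the reason for \<open>3 \<le> r\<close>.
\<close>

lemma bipartite_shape_oriented:
  assumes host: "bipartite A B E" and S: "S \<subseteq> A \<union> B"
    and shape: "bipartite_shape s r S {e \<in> E. e \<subseteq> S}" and "3 \<le> r"
  obtains a b where "inj_on a {1..r}" "a ` {1..r} \<subseteq> A" "inj_on b {1..r}" "b ` {1..r} \<subseteq> B"
    "\<And>i j. i \<in> {1..r} \<Longrightarrow> j \<in> {1..r} \<Longrightarrow> {b i, a j} \<in> E \<longleftrightarrow> pattern s i j"
proof -
  note choose = that
  define I where "I = {1..r}"
  obtain v W where vW: "has_shape s r S {e \<in> E. e \<subseteq> S} v W \<and> (\<forall>i\<in>I. card (W i) = 1) \<and>
      bipartite (v ` I) (\<Union>i\<in>I. W i) {e \<in> E. e \<subseteq> S}"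
    using shape unfolding bipartite_shape_def I_def[symmetric] by (elim exE) (rule that)
  then have has: "has_shape s r S {e \<in> E. e \<subseteq> S} v W"
    and card1: "\<And>i. i \<in> I \<Longrightarrow> card (W i) = 1"
    and bip: "bipartite (v ` I) (\<Union>i\<in>I. W i) {e \<in> E. e \<subseteq> S}"
    by blast+
  define w where "w i = the_elem (W i)" for i
  have W: "W i = {w i}" if "i \<in> I" for i
    using card1[OF that] by (metis card_1_singletonE the_elem_eq w_def)
  have part: "partitioned r S {e \<in> E. e \<subseteq> S} v W"
    using has by (simp add: has_shape_iff_pattern)
  have inS: "v i \<in> S" "w i \<in> S" if "i \<in> I" for i
    using part that W[OF that] unfolding partitioned_def I_def by blast+
  have inj_v: "inj_on v I"
    using part by (simp add: partitioned_def I_def)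
  have inj_w: "inj_on w I"
    using part W unfolding partitioned_def I_def disjoint_family_on_def inj_on_def by blast
  have vw: "v i \<noteq> w j" if "i \<in> I" "j \<in> I" for i j
    using part W that unfolding partitioned_def I_def by blast
  have adj: "{v i, w j} \<in> E \<longleftrightarrow> pattern s i j" if "i \<in> I" "j \<in> I" for i j
    using has W inS that unfolding has_shape_iff_pattern I_def by auto
  have AB: "A \<inter> B = {}"
    using host by (simp add: bipartite_def)
  have sides: "v i \<in> A \<longleftrightarrow> w j \<in> B" "v i \<in> B \<longleftrightarrow> w j \<in> A"
    if "pattern s i j" "i \<in> I" "j \<in> I" for i j
    using bipartite_edge_sides[OF host] adj that by blast+
  have side_cases: "v i \<in> A \<and> v i \<notin> B \<or> v i \<in> B \<and> v i \<notin> A" if "i \<in> I" for i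
    using inS[OF that] S AB by blast
  have thesisI: thesis
    if "inj_on a I" "a ` I \<subseteq> A" "inj_on b I" "b ` I \<subseteq> B"
      "\<And>i j. i \<in> I \<Longrightarrow> j \<in> I \<Longrightarrow> {b i, a j} \<in> E \<longleftrightarrow> pattern s i j" for a b
    using that unfolding I_def by (rule choose)
  have column: "\<exists>i\<in>I. pattern s i j" if "j \<in> I" for j
  proof -
    have "pattern s j j \<or> pattern s 1 j \<or> pattern s 2 j" "1 \<in> I" "2 \<in> I"
      using that \<open>3 \<le> r\<close> by (cases s; auto simp: pattern_def I_def)+
    then show ?thesis
      using that by blast
  qed
  have X_in_B: thesis if "v ` I \<subseteq> B"
  proof (rule thesisI)
    show "w ` I \<subseteq> A"
    proof (rule image_subsetI)
      fix j assume j: "j \<in> I"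
      then show "w j \<in> A"
        using that column[OF j] sides(2)[of _ j] by blast
    qed
  qed (use that inj_v inj_w adj in auto)
  have X_in_A: thesis if "v ` I \<subseteq> A"
  proof -
    \<comment> \<open>Reversing the indices turns \<open>j \<le> i\<close> into \<open>i \<le> j\<close>, which makes up for exchanging the sides;
      equality of indices is not affected.\<close>
    define \<rho> where "\<rho> i = r + 1 - i" for i
    have \<rho>: "\<rho> i \<in> I" if "i \<in> I" for i
      using that by (auto simp: \<rho>_def I_def)
    have inj_\<rho>: "inj_on \<rho> I"
      by (auto simp: \<rho>_def I_def inj_on_def)
    show thesis
    proof (rule thesisI)
      show "inj_on (v \<circ> \<rho>) I" "inj_on (w \<circ> \<rho>) I"
        using inj_\<rho> inj_v inj_w \<rho> by (meson comp_inj_on image_subsetI inj_on_subset)+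
      show "(v \<circ> \<rho>) ` I \<subseteq> A"
        using that \<rho> by auto
      show "(w \<circ> \<rho>) ` I \<subseteq> B"
      proof (rule image_subsetI)
        fix i assume "i \<in> I"
        then have j: "\<rho> i \<in> I" (is "?j \<in> I")
          by (rule \<rho>)
        then have "w ?j \<in> B"
          using that column[OF j] sides(1)[of _ ?j] by blast
        then show "(w \<circ> \<rho>) i \<in> B"
          by simp
      qed
      fix i j assume ij: "i \<in> I" "j \<in> I"
      have "{(w \<circ> \<rho>) i, (v \<circ> \<rho>) j} \<in> E \<longleftrightarrow> pattern s (\<rho> j) (\<rho> i)"
        using adj[of "\<rho> j" "\<rho> i"] \<rho> ij by (simp add: insert_commute)
      also have "\<dots> \<longleftrightarrow> pattern s i j"
        using ij by (cases s) (auto simp: pattern_def \<rho>_def I_def)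
      finally show "{(w \<circ> \<rho>) i, (v \<circ> \<rho>) j} \<in> E \<longleftrightarrow> pattern s i j" .
    qed
  qed
  show thesis
  proof (cases "s = Star")
    case True
    have star: "pattern s i j \<longleftrightarrow> i = j" for i j
      by (simp add: True pattern_def)
    have vv: "{v i, v j} \<notin> E" and ww: "{w i, w j} \<notin> E" if "i \<in> I" "j \<in> I" "i \<noteq> j" for i j
    proof -
      have "indep (v ` I) {e \<in> E. e \<subseteq> S}" "indep (w ` I) {e \<in> E. e \<subseteq> S}"
        using bip W by (simp_all add: bipartite_def UNION_singleton_eq_range)
      then show "{v i, v j} \<notin> E" "{w i, w j} \<notin> E"
        using that inS inj_on_eq_iff[OF inj_v] inj_on_eq_iff[OF inj_w] unfolding indep_def by auto
    qed
    define a where "a i = (if v i \<in> A then v i else w i)" for i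
    define b where "b i = (if v i \<in> A then w i else v i)" for i
    show thesis
    proof (rule thesisI)
      show "inj_on a I" "inj_on b I"
        using inj_v inj_w vw unfolding inj_on_def a_def b_def by metis+
      show "a ` I \<subseteq> A" "b ` I \<subseteq> B"
        using side_cases sides star by (auto simp: a_def b_def)
      fix i j assume ij: "i \<in> I" "j \<in> I"
      show "{b i, a j} \<in> E \<longleftrightarrow> pattern s i j"
        using adj[OF ij] adj[OF ij(2,1)] vv[OF ij] ww[OF ij]
        by (cases "i = j") (auto simp: a_def b_def star insert_commute)
    qed
  next
    case False
    have "v i \<in> A \<longleftrightarrow> v 1 \<in> A" if "i \<in> I" for i
    proof -
      have "\<exists>l\<in>I. pattern s i l \<and> pattern s 1 l"
      \<comment> \<open>\<open>v i\<close> and \<open>v 1\<close> have a common neighbour \<open>w l\<close>; in a costar take any \<open>l\<close> other than \<open>i\<close> and 1.\<close>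
      proof (cases s)
        case Costar
        have "(if i = 2 then 3 else 2) \<in> I \<and>
          pattern s i (if i = 2 then 3 else 2) \<and> pattern s 1 (if i = 2 then 3 else 2)"
          using \<open>3 \<le> r\<close> by (auto simp: Costar pattern_def I_def)
        then show ?thesis
          by blast
      next
        case Skewchain
        then have "1 \<in> I \<and> pattern s i 1 \<and> pattern s 1 1"
          using that by (auto simp: pattern_def I_def)
        then show ?thesis
          by blast
      qed (use False in simp)
      moreover have "1 \<in> I"
        using that by (auto simp: I_def)
      ultimately show ?thesis
        using sides(1) that by blast
    qed
    then have "v ` I \<subseteq> A \<or> v ` I \<subseteq> B"
      using side_cases by blast
    then show thesis
      using X_in_A X_in_B by blast
  qed
qed

section \<open>From distinct neighbourhoods to a pattern\<close>

lemma bipartite_forcing_diagonalE: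
  fixes A B :: "nat set"
  assumes "bipartite_forcing r r r N" "bipartite A B E" "card A = N" "inj_on (nbhd E (A \<union> B)) A"
  obtains S s where "S \<subseteq> A \<union> B" "bipartite_shape s r S {e \<in> E. e \<subseteq> S}"
proof -
  have "contains_induced (A \<union> B) E (matching r) \<or> contains_induced (A \<union> B) E (comatching r) \<or>
      contains_induced (A \<union> B) E (halfgraph r)"
    using assms(1)[unfolded bipartite_forcing_def, rule_format, of A B E] assms(2-4) by blast
  then obtain s where "contains_induced (A \<union> B) E (bipartite_shape s r)"
    by blast
  then show thesis
    unfolding contains_induced_def by (elim exE conjE) (rule that)
qed

text \<open>
  This brings the forcing property to bear on arbitrary set systems.  The incidence graph of the sets
  \<open>nb i\<close> is drawn on the natural numbers, with even numbers for the sets and odd numbers for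
  the elements of \<open>X\<close>; being a copy, it is bipartite no matter how the sets arise from \<open>X\<close>.
\<close>

lemma bipartite_forcing_pattern:
  fixes X :: "'a set" and nb :: "nat \<Rightarrow> 'a set"
  assumes forcing: "bipartite_forcing r r r N" and "3 \<le> r" and "finite X"
    and nb: "nb ` {1..N} \<subseteq> Pow X" and inj: "inj_on nb {1..N}"
  obtains s x \<sigma> where "inj_on x {1..r}" "x ` {1..r} \<subseteq> X" "inj_on \<sigma> {1..r}" "\<sigma> ` {1..r} \<subseteq> {1..N}"
    "\<And>i j. i \<in> {1..r} \<Longrightarrow> j \<in> {1..r} \<Longrightarrow> x i \<in> nb (\<sigma> j) \<longleftrightarrow> pattern s i j"
proof -
  note choose = that
  obtain g :: "'a \<Rightarrow> nat" where g: "inj_on g X"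
    using finite_imp_inj_to_nat_seg[OF \<open>finite X\<close>] by blast
  define \<alpha> :: "nat \<Rightarrow> nat" where "\<alpha> i = 2 * i" for i
  define \<beta> where "\<beta> x = Suc (2 * g x)" for x
  have inj_\<alpha>: "inj \<alpha>"
    by (auto simp: \<alpha>_def inj_on_def)
  have inj_\<beta>: "inj_on \<beta> X"
    using g by (auto simp: \<beta>_def inj_on_def)
  have \<alpha>\<beta>: "\<alpha> i \<noteq> \<beta> x" for i x
    unfolding \<alpha>_def \<beta>_def by presburger
  define A where "A = \<alpha> ` {1..N}"
  define B where "B = \<beta> ` X"
  define F where "F = (\<Union>i\<in>{1..N}. \<Union>x\<in>nb i. {{\<alpha> i, \<beta> x}})"
  have nbX: "x \<in> X" if "i \<in> {1..N}" "x \<in> nb i" for i x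
    using nb that by blast
  have edge: "{\<alpha> i, \<beta> x} \<in> F \<longleftrightarrow> x \<in> nb i" if "i \<in> {1..N}" "x \<in> X" for i x
  proof
    assume "{\<alpha> i, \<beta> x} \<in> F"
    then obtain i' x' where i'x': "i' \<in> {1..N}" "x' \<in> nb i'" "{\<alpha> i, \<beta> x} = {\<alpha> i', \<beta> x'}"
      unfolding F_def by blast
    then have "\<alpha> i = \<alpha> i'" "\<beta> x = \<beta> x'"
      using \<alpha>\<beta> by (metis doubleton_eq_iff)+
    then show "x \<in> nb i"
      using i'x' that nbX inj_\<alpha> inj_\<beta> by (metis injD inj_onD)
  next
    assume "x \<in> nb i"
    then show "{\<alpha> i, \<beta> x} \<in> F"
      using that unfolding F_def by blast
  qed
  have AB: "A \<inter> B = {}"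
    using \<alpha>\<beta> by (auto simp: A_def B_def)
  have F_cross: "\<exists>a\<in>A. \<exists>b\<in>B. e = {a, b}" if "e \<in> F" for e
    using that nbX unfolding F_def A_def B_def by blast
  have "F \<subseteq> [A \<union> B]\<^bsup>2\<^esup>"
    using F_cross AB by fastforce
  moreover have "indep A F" "indep B F"
    using F_cross AB unfolding indep_def by (metis disjoint_iff doubleton_eq_iff)+
  ultimately have bip: "bipartite A B F"
    using AB \<open>finite X\<close> by (simp add: bipartite_def graph_def A_def B_def)
  have card_A: "card A = N"
    using inj_\<alpha> by (simp add: A_def card_image inj_on_subset)
  have nbhd_\<alpha>: "nbhd F (A \<union> B) (\<alpha> i) = \<beta> ` nb i" if "i \<in> {1..N}" for i
  proof
    show "nbhd F (A \<union> B) (\<alpha> i) \<subseteq> \<beta> ` nb i"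
    proof
      fix y assume "y \<in> nbhd F (A \<union> B) (\<alpha> i)"
      then have y: "{\<alpha> i, y} \<in> F"
        by (simp add: nbhd_def)
      then have "y \<in> B"
        using bipartite_edge_sides(1)[OF bip y] that by (simp add: A_def)
      then show "y \<in> \<beta> ` nb i"
        using y edge[OF that] by (auto simp: B_def)
    qed
    show "\<beta> ` nb i \<subseteq> nbhd F (A \<union> B) (\<alpha> i)"
      using edge[OF that] nbX[OF that] by (auto simp: nbhd_def B_def)
  qed
  have "inj_on (nbhd F (A \<union> B)) A"
  proof (rule inj_onI)
    fix a a' assume "a \<in> A" "a' \<in> A" and eq: "nbhd F (A \<union> B) a = nbhd F (A \<union> B) a'"
    then obtain i i' where i: "i \<in> {1..N}" "a = \<alpha> i" "i' \<in> {1..N}" "a' = \<alpha> i'"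
      unfolding A_def by blast
    then have "\<beta> ` nb i = \<beta> ` nb i'"
      using eq nbhd_\<alpha> by simp
    then have "nb i = nb i'"
      using inj_\<beta> i nb by (metis PowD imageI inj_on_image_eq_iff subsetD)
    then show "a = a'"
      using inj i by (simp add: inj_on_eq_iff)
  qed
  then obtain S s where S: "S \<subseteq> A \<union> B" "bipartite_shape s r S {e \<in> F. e \<subseteq> S}"
    by (rule bipartite_forcing_diagonalE[OF forcing bip card_A])
  obtain a b where ab: "inj_on a {1..r}" "a ` {1..r} \<subseteq> A" "inj_on b {1..r}" "b ` {1..r} \<subseteq> B"
    "\<And>i j. i \<in> {1..r} \<Longrightarrow> j \<in> {1..r} \<Longrightarrow> {b i, a j} \<in> F \<longleftrightarrow> pattern s i j"
    using bipartite_shape_oriented[OF bip S \<open>3 \<le> r\<close>] by metis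
  have "\<forall>j\<in>{1..r}. \<exists>i\<in>{1..N}. a j = \<alpha> i" "\<forall>i\<in>{1..r}. \<exists>x\<in>X. b i = \<beta> x"
    using ab(2,4) unfolding A_def B_def by blast+
  then obtain \<sigma> x where \<sigma>: "\<And>j. j \<in> {1..r} \<Longrightarrow> \<sigma> j \<in> {1..N} \<and> a j = \<alpha> (\<sigma> j)"
    and x: "\<And>i. i \<in> {1..r} \<Longrightarrow> x i \<in> X \<and> b i = \<beta> (x i)"
    by metis
  show thesis
  proof (rule choose)
    show "inj_on \<sigma> {1..r}" "inj_on x {1..r}"
      using ab(1,3) \<sigma> x unfolding inj_on_def by metis+
    show "x ` {1..r} \<subseteq> X" "\<sigma> ` {1..r} \<subseteq> {1..N}"
      using \<sigma> x by blast+
    fix i j assume ij: "i \<in> {1..r}" "j \<in> {1..r}"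
    then show "x i \<in> nb (\<sigma> j) \<longleftrightarrow> pattern s i j"
      using ab(5)[OF ij] edge[of "\<sigma> j" "x i"] \<sigma>[of j] x[of i] by (simp add: insert_commute)
  qed
qed

text \<open>
  A bipartite shape with \<open>r \<ge> 1\<close> has two vertices, and so is not contained in an edgeless graph
  with \<open>N < 2\<close> vertices and empty second side.
\<close>

lemma bipartite_forcing_ge_2:
  assumes "bipartite_forcing r r r N" "1 \<le> r"
  shows "2 \<le> N"
proof (rule ccontr)
  assume "\<not> 2 \<le> N"
  then have "inj_on (nbhd {} ({..<N} \<union> {})) {..<N}"
    by (auto simp: inj_on_def)
  moreover have "bipartite {..<N} {} {}"
    by (simp add: bipartite_def graph_def indep_def)
  ultimately obtain S s where S: "S \<subseteq> {..<N}" "bipartite_shape s r S {e \<in> {}. e \<subseteq> S}"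
    using bipartite_forcing_diagonalE[OF assms(1), of "{..<N}" "{}" "{}"] by auto
  then obtain v W where part: "partitioned r S {e \<in> {}. e \<subseteq> S} v W"
      and card1: "\<forall>i\<in>{1..r}. card (W i) = 1"
    unfolding bipartite_shape_def has_shape_iff_pattern by (elim exE conjE) (rule that)
  have 1: "1 \<in> {1..r}"
    using assms(2) by simp
  then obtain w where "W 1 = {w}"
    using card1 card_1_singletonE by blast
  then have "v 1 \<in> S" "w \<in> S" "v 1 \<noteq> w"
    using part 1 unfolding partitioned_def by blast+
  then have "v 1 < N" "w < N"
    using S(1) by blast+
  then show False
    using \<open>v 1 \<noteq> w\<close> \<open>\<not> 2 \<le> N\<close> by linarith
qed

section \<open>Finding the unavoidable graphs\<close>

lemma contains_U_graphI:
  assumes "graph V E" "v ` {1..r} \<subseteq> V" "inj_on v {1..r}"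
    and "\<And>i. i \<in> {1..r} \<Longrightarrow> W i \<subseteq> V" "disjoint_family_on W {1..r}"
    and "\<And>i. i \<in> {1..r} \<Longrightarrow> v ` {1..r} \<inter> W i = {}"
    and "\<And>i. i \<in> {1..r} \<Longrightarrow> card (W i) = r"
    and "\<And>i j w. i \<in> {1..r} \<Longrightarrow> j \<in> {1..r} \<Longrightarrow> w \<in> W j \<Longrightarrow> {v i, w} \<in> E \<longleftrightarrow> pattern s i j"
    and "if xc then clique (v ` {1..r}) E else indep (v ` {1..r}) E"
    and "\<And>i. i \<in> {1..r} \<Longrightarrow> if vc then clique (W i) E else indep (W i) E"
    and "\<And>i j. i \<in> {1..r} \<Longrightarrow> j \<in> {1..r} \<Longrightarrow> i \<noteq> j \<Longrightarrow>
      if jc then joined E (W i) (W j) else cojoined E (W i) (W j)"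
  shows "contains_induced V E (U_graph (s, xc, vc, jc) r)"
proof -
  define S where "S = v ` {1..r} \<union> (\<Union>i\<in>{1..r}. W i)"
  define F where "F = {e \<in> E. e \<subseteq> S}"
  have SV: "S \<subseteq> V"
    using assms(2,4) unfolding S_def by blast
  have edge: "{a, b} \<in> F \<longleftrightarrow> {a, b} \<in> E" if "a \<in> S" "b \<in> S" for a b
    using that by (simp add: F_def)
  have vS: "v i \<in> S" and WS: "w \<in> S" if "i \<in> {1..r}" "w \<in> W i" for i w
    using that unfolding S_def by blast+
  have clq: "clique T F = clique T E" "indep T F = indep T E" if "T \<subseteq> S" for T
    using that edge unfolding clique_def indep_def by (meson subsetD)+
  have jnd: "joined F T T' = joined E T T'" "cojoined F T T' = cojoined E T T'"
    if "T \<subseteq> S" "T' \<subseteq> S" for T T'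
    using that edge unfolding joined_def cojoined_def by (meson subsetD)+
  have sub: "v ` {1..r} \<subseteq> S" "\<And>i. i \<in> {1..r} \<Longrightarrow> W i \<subseteq> S"
    unfolding S_def by blast+
  have "graph S F"
    using assms(1) SV unfolding graph_def F_def nsets_def by (auto intro: finite_subset)
  then have "partitioned r S F v W"
    using assms(3,5,6) by (simp add: partitioned_def S_def)
  moreover have "{v i, w} \<in> F \<longleftrightarrow> pattern s i j" if "i \<in> {1..r}" "j \<in> {1..r}" "w \<in> W j" for i j w
    using assms(8)[OF that] edge[of "v i" w] sub that by blast
  ultimately have "has_shape s r S F v W"
    by (simp add: has_shape_iff_pattern)
  moreover have "if xc then clique (v ` {1..r}) F else indep (v ` {1..r}) F"
    using assms(9) clq[OF sub(1)] by (simp only:)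
  moreover have "if vc then clique (W i) F else indep (W i) F" if "i \<in> {1..r}" for i
    using assms(10)[OF that] clq[OF sub(2)[OF that]] by (simp only:)
  moreover have "if jc then joined F (W i) (W j) else cojoined F (W i) (W j)"
    if "i \<in> {1..r}" "j \<in> {1..r}" "i \<noteq> j" for i j
    using assms(11)[OF that] jnd[OF sub(2)[OF that(1)] sub(2)[OF that(2)]] by (simp only:)
  ultimately have "U_graph (s, xc, vc, jc) r S F"
    using assms(7) unfolding U_graph.simps by (intro exI[of _ v] exI[of _ W]) blast
  then show ?thesis
    using SV unfolding contains_induced_def F_def by blast
qed

text \<open>
  The Ramsey-type clean-up.  The four colours take care of the adjacencies within \<open>X\<close> and between
  the parts; the type of each part is a property of a single index, so pigeonhole suffices for it,
  which is why \<open>2m - 1\<close> indices are asked for.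
\<close>

lemma contains_U_graph_of_pattern:
  assumes M: "M = ramsey4 (2 * m - 1)" and graph: "graph V E"
    and x: "inj_on x {1..M}" "x ` {1..M} \<subseteq> V"
    and P_V: "\<And>i. i \<in> {1..M} \<Longrightarrow> P i \<subseteq> V" and disj_P: "disjoint_family_on P {1..M}"
    and x_P: "\<And>i. i \<in> {1..M} \<Longrightarrow> x ` {1..M} \<inter> P i = {}"
    and card_P: "\<And>i. i \<in> {1..M} \<Longrightarrow>
      ramsey_number m * 2 ^ ((2 ^ M - 2) * ramsey_number m) \<le> card (P i)"
    and adj: "\<And>i j w. i \<in> {1..M} \<Longrightarrow> j \<in> {1..M} \<Longrightarrow> w \<in> P j \<Longrightarrow>
      {x i, w} \<in> E \<longleftrightarrow> pattern s i j"
  shows "\<exists>xc vc jc. contains_induced V E (U_graph (s, xc, vc, jc) m)"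
proof -
  have fin_P: "finite (P i)" if "i \<in> {1..M}" for i
    using P_V[OF that] graph unfolding graph_def by (meson finite_subset)
  have card_P': "ramsey_number m * 2 ^ ((2 ^ card {1..M} - 2) * ramsey_number m) \<le> card (P i)"
    if "i \<in> {1..M}" for i
    using card_P[OF that] by simp
  obtain W where W: "\<And>i. i \<in> {1..M} \<Longrightarrow> W i \<subseteq> P i"
      "\<And>i. i \<in> {1..M} \<Longrightarrow> ramsey_number m \<le> card (W i)"
      "\<And>i j. i \<in> {1..M} \<Longrightarrow> j \<in> {1..M} \<Longrightarrow> i \<noteq> j \<Longrightarrow>
        joined E (W i) (W j) \<or> cojoined E (W i) (W j)"
    using homogeneous_subsets[OF finite_atLeastAtMost disj_P fin_P card_P', of E] by metis
  have "\<exists>D\<subseteq>W i. card D = m \<and> (clique D E \<or> indep D E)" if "i \<in> {1..M}" for i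
    using ramsey_number_subset W(1,2)[OF that] fin_P[OF that] finite_subset by metis
  then obtain D where D: "\<And>i. i \<in> {1..M} \<Longrightarrow> D i \<subseteq> W i" "\<And>i. i \<in> {1..M} \<Longrightarrow> card (D i) = m"
      "\<And>i. i \<in> {1..M} \<Longrightarrow> clique (D i) E \<or> indep (D i) E"
    by metis
  have hom: "joined E (D i) (D j) \<or> cojoined E (D i) (D j)"
    if "i \<in> {1..M}" "j \<in> {1..M}" "i \<noteq> j" for i j
    using W(3)[OF that] D(1)[OF that(1)] D(1)[OF that(2)]
    unfolding joined_def cojoined_def by blast
  obtain H xc jc where H: "H \<subseteq> {1..M}" "card H = 2 * m - 1"
    and mono: "\<And>i j. i \<in> H \<Longrightarrow> j \<in> H \<Longrightarrow> i \<noteq> j \<Longrightarrow>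
      (x ` {i, j} \<in> E \<longleftrightarrow> xc) \<and>
      ((\<exists>a\<in>{i, j}. \<exists>b\<in>{i, j}. a \<noteq> b \<and> joined E (D a) (D b)) \<longleftrightarrow> jc)"
    using ramsey4_homogeneous[of "2 * m - 1" "\<lambda>e. x ` e \<in> E"
        "\<lambda>e. \<exists>a\<in>e. \<exists>b\<in>e. a \<noteq> b \<and> joined E (D a) (D b)"] M by metis
  have x_mono: "{x i, x j} \<in> E \<longleftrightarrow> xc" if "i \<in> H" "j \<in> H" "i \<noteq> j" for i j
    using mono[OF that] by simp
  have j_mono: "if jc then joined E (D i) (D j) else cojoined E (D i) (D j)"
    if "i \<in> H" "j \<in> H" "i \<noteq> j" for i j
  proof -
    have "i \<in> {1..M}" "j \<in> {1..M}"
      using that H(1) by blast+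
    then have "joined E (D i) (D j) \<or> cojoined E (D i) (D j)"
      using hom that(3) by blast
    then show ?thesis
      using mono[OF that] that(3) by (auto simp: joined_commute)
  qed
  have "finite H"
    using H(1) finite_subset by blast
  have "\<exists>T\<subseteq>H. m \<le> card T \<and> (\<forall>i\<in>T. \<forall>j\<in>T. clique (D i) E = clique (D j) E)"
  proof -
    define Y where "Y = {i \<in> H. clique (D i) E}"
    have "card Y + card (H - Y) = 2 * m - 1"
      using \<open>finite H\<close> H(2) by (metis (no_types, lifting) Y_def add_diff_inverse_nat card_Diff_subset
          card_mono finite_subset linorder_not_less mem_Collect_eq subsetI)
    then have "m \<le> card Y \<or> m \<le> card (H - Y)"
      by linarith
    then show ?thesis
    proof
      assume "m \<le> card Y"
      then show ?thesis
        by (intro exI[of _ Y]) (auto simp: Y_def)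
    next
      assume "m \<le> card (H - Y)"
      then show ?thesis
        by (intro exI[of _ "H - Y"]) (auto simp: Y_def)
    qed
  qed
  then obtain T vc where T: "T \<subseteq> H" "m \<le> card T" "\<And>i. i \<in> T \<Longrightarrow> clique (D i) E = vc"
    by metis
  have "finite T"
    using T(1) \<open>finite H\<close> finite_subset by blast
  then obtain h where h: "strict_mono_on {..<card T} h" "\<forall>n<card T. h n \<in> T"
    using finite_enumerate by blast
  \<comment> \<open>Increasing, as required for a skewchain, and shifted because indices start at 1.\<close>
  define e where "e i = h (i - 1)" for i
  have e: "strict_mono_on {1..m} e" "\<And>i. i \<in> {1..m} \<Longrightarrow> e i \<in> T"
  proof -
    show "strict_mono_on {1..m} e"
    proof (rule strict_mono_onI)
      fix i j assume "i \<in> {1..m}" "j \<in> {1..m}" "i < j"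
      then show "e i < e j"
        using strict_mono_onD[OF h(1), of "i - 1" "j - 1"] T(2) by (auto simp: e_def)
    qed
    show "e i \<in> T" if "i \<in> {1..m}" for i
      using h(2) T(2) that by (auto simp: e_def)
  qed
  have eH: "e i \<in> H" and eM: "e i \<in> {1..M}" if "i \<in> {1..m}" for i
    using e(2)[OF that] T(1) H(1) by blast+
  have inj_e: "i = j" if "e i = e j" "i \<in> {1..m}" "j \<in> {1..m}" for i j
    using strict_mono_on_eq[OF e(1)] that by blast
  have x_e: "(x \<circ> e) ` {1..m} \<subseteq> x ` {1..M}"
    using eM by (auto simp del: atLeastAtMost_iff)
  have DP: "D i \<subseteq> P i" if "i \<in> {1..M}" for i
    using D(1)[OF that] W(1)[OF that] by blast
  have "contains_induced V E (U_graph (s, xc, vc, jc) m)"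
  proof (rule contains_U_graphI[where v = "x \<circ> e" and W = "D \<circ> e"])
    show "graph V E"
      by (rule graph)
    show "(x \<circ> e) ` {1..m} \<subseteq> V"
      using eM x(2) by (auto simp del: atLeastAtMost_iff)
    show "inj_on (x \<circ> e) {1..m}"
    proof (rule inj_onI)
      fix i j assume ij: "i \<in> {1..m}" "j \<in> {1..m}" "(x \<circ> e) i = (x \<circ> e) j"
      then have "e i = e j"
        using inj_onD[OF x(1) _ eM eM] by simp
      then show "i = j"
        using inj_e ij by blast
    qed
    show "disjoint_family_on (D \<circ> e) {1..m}"
      using disj_P DP eM inj_e unfolding disjoint_family_on_def comp_def by blast
    show "if xc then clique ((x \<circ> e) ` {1..m}) E else indep ((x \<circ> e) ` {1..m}) E"
    proof -
      have "{x (e i), x (e j)} \<in> E \<longleftrightarrow> xc"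
        if "i \<in> {1..m}" "j \<in> {1..m}" "x (e i) \<noteq> x (e j)" for i j
        using x_mono[OF eH eH] that by metis
      then show ?thesis
        by (simp add: clique_def indep_def del: atLeastAtMost_iff)
    qed
  next
    fix i assume i: "i \<in> {1..m}"
    note eM = eM[OF i]
    show "(D \<circ> e) i \<subseteq> V"
      using DP[OF eM] P_V[OF eM] by auto
    show "(x \<circ> e) ` {1..m} \<inter> (D \<circ> e) i = {}"
      using DP[OF eM] x_P[OF eM] x_e by (simp del: image_comp) blast
    show "card ((D \<circ> e) i) = m"
      using D(2)[OF eM] by simp
    show "if vc then clique ((D \<circ> e) i) E else indep ((D \<circ> e) i) E"
      using T(3)[OF e(2)[OF i]] D(3)[OF eM] by auto
  next
    fix i j w assume "i \<in> {1..m}" "j \<in> {1..m}" "w \<in> (D \<circ> e) j"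
    then show "{(x \<circ> e) i, w} \<in> E \<longleftrightarrow> pattern s i j"
      using adj[of "e i" "e j" w] eM DP[of "e j"] pattern_strict_mono[OF e(1)] by auto
  next
    fix i j assume "i \<in> {1..m}" "j \<in> {1..m}" "i \<noteq> j"
    then show "if jc then joined E ((D \<circ> e) i) ((D \<circ> e) j) else cojoined E ((D \<circ> e) i) ((D \<circ> e) j)"
      using j_mono eH inj_e by (metis comp_apply)
  qed
  then show ?thesis
    by blast
qed

theorem theorem5p4:
  fixes m M l k :: nat
    and f :: "nat \<Rightarrow> nat \<Rightarrow> nat \<Rightarrow> nat"
    and V X :: "'a set" and E :: "'a set set" and U :: "nat \<Rightarrow> 'a set"
  assumes "m \<ge> 1"
    and "\<And>p q r. bipartite_forcing p q r (f p q r)"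
    and "M = ramsey4 (2 * m - 1)"
    and "l = f M M M"
    and "k = n_parts M (ramsey_number m)"
    and "graph V E"
    and "distinguishes V E X l U"
    and "\<forall>i\<in>{1..l}. card (U i) = k"
  shows "\<exists>i. contains_induced V E (U_graph i m)"
proof -
  have "2 * m - 1 \<le> M"
    using assms(3) ramsey4_ge by simp
  have forcing: "bipartite_forcing M M M l"
    using assms(2,4) by simp
  have t: "1 \<le> ramsey_number m"
    using ramsey_number_ge[of m] assms(1) by simp
  have "1 \<le> k"
    using t assms(5) by (simp add: n_parts_def)
  then have ne: "U i \<noteq> {}" if "i \<in> {1..l}" for i
    using assms(8) that by (metis card.empty not_one_le_zero)
  have UV: "\<And>i. i \<in> {1..l} \<Longrightarrow> U i \<subseteq> V" and disj_U: "disjoint_family_on U {1..l}" and "X \<subseteq> V"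
    using assms(7) by (simp_all add: distinguishes_def)
  have same: "nbhd E X u = nbhd E X u'" if "i \<in> {1..l}" "u \<in> U i" "u' \<in> U i" for i u u'
    using assms(7) that unfolding distinguishes_def by blast
  have diff: "nbhd E X u \<noteq> nbhd E X u'"
    if "i \<in> {1..l}" "j \<in> {1..l}" "i \<noteq> j" "u \<in> U i" "u' \<in> U j" for i j u u'
    using assms(7) that unfolding distinguishes_def by blast
  have "finite V"
    using assms(6) by (simp add: graph_def)
  show ?thesis
  proof (cases "m = 1")
    case True
    \<comment> \<open>The graphs \<open>U\<^sup>1\<close> are just an edge and a non-edge, so any two distinct vertices suffice.\<close>
    have "2 \<le> l"
      using bipartite_forcing_ge_2[OF forcing] \<open>2 * m - 1 \<le> M\<close> assms(1) by linarith
    then have 12: "1 \<in> {1..l}" "2 \<in> {1..l}"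
      by auto
    then obtain a b where ab: "a \<in> U 1" "b \<in> U 2"
      using ne by blast
    then have "a \<noteq> b"
      using disj_U 12 unfolding disjoint_family_on_def
      by (metis disjoint_iff numeral_eq_one_iff semiring_norm(85))
    have "a \<in> V" "b \<in> V"
      using ab UV 12 by blast+
    define s where "s = (if {a, b} \<in> E then Star else Costar)"
    have "contains_induced V E (U_graph (s, True, True, True) m)"
      by (rule contains_U_graphI[where v = "\<lambda>_. a" and W = "\<lambda>_. {b}"])
        (use \<open>a \<in> V\<close> \<open>b \<in> V\<close> \<open>a \<noteq> b\<close> assms(6) True in
          \<open>auto simp: s_def pattern_def clique_def disjoint_family_on_def\<close>)
    then show ?thesis
      by blast
  next
    case False
    then have "2 \<le> m"
      using assms(1) by simp
    then have "3 \<le> M"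
      using \<open>2 * m - 1 \<le> M\<close> by linarith
    define u where "u i = (SOME u. u \<in> U i)" for i
    have u: "u i \<in> U i" if "i \<in> {1..l}" for i
      using ne[OF that] by (simp add: u_def some_in_eq)
    define nb where "nb i = nbhd E X (u i)" for i
    have "finite X"
      using \<open>X \<subseteq> V\<close> \<open>finite V\<close> finite_subset by blast
    moreover have "nb ` {1..l} \<subseteq> Pow X"
      by (auto simp: nb_def nbhd_def)
    moreover have "inj_on nb {1..l}"
      using diff u unfolding inj_on_def nb_def by blast
    ultimately obtain s x \<sigma> where x: "inj_on x {1..M}" "x ` {1..M} \<subseteq> X"
      and \<sigma>: "inj_on \<sigma> {1..M}" "\<sigma> ` {1..M} \<subseteq> {1..l}"
      and pat: "\<And>i j. i \<in> {1..M} \<Longrightarrow> j \<in> {1..M} \<Longrightarrow> x i \<in> nb (\<sigma> j) \<longleftrightarrow> pattern s i j"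
      using bipartite_forcing_pattern[OF forcing \<open>3 \<le> M\<close>] by metis
    have \<sigma>l: "\<sigma> j \<in> {1..l}" if "j \<in> {1..M}" for j
      using \<sigma>(2) that by blast
    \<comment> \<open>The sets \<open>U (\<sigma> j)\<close> may contain some \<open>x i\<close>.\<close>
    define P where "P j = U (\<sigma> j) - x ` {1..M}" for j
    have PU: "P j \<subseteq> U (\<sigma> j)" for j
      by (auto simp: P_def)
    have adj: "{x i, w} \<in> E \<longleftrightarrow> pattern s i j" if "i \<in> {1..M}" "j \<in> {1..M}" "w \<in> P j" for i j w
    proof -
      have "x i \<in> X"
        using x(2) that(1) by blast
      have "w \<in> U (\<sigma> j)"
        using that(3) PU by blast
      then have "nbhd E X w = nb (\<sigma> j)"
        using same[OF \<sigma>l[OF that(2)]] u[OF \<sigma>l[OF that(2)]] unfolding nb_def by blast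
      then have "x i \<in> nbhd E X w \<longleftrightarrow> pattern s i j"
        using pat that by simp
      then show ?thesis
        using \<open>x i \<in> X\<close> by (simp add: nbhd_def insert_commute)
    qed
    have disj_P: "disjoint_family_on P {1..M}"
    proof -
      have "P i \<inter> P j = {}" if "i \<in> {1..M}" "j \<in> {1..M}" "i \<noteq> j" for i j
      proof -
        have "\<sigma> i \<noteq> \<sigma> j"
          using \<sigma>(1) that by (simp add: inj_on_eq_iff)
        then have "U (\<sigma> i) \<inter> U (\<sigma> j) = {}"
          using disj_U \<sigma>l that unfolding disjoint_family_on_def by simp
        then show ?thesis
          using PU[of i] PU[of j] by blast
      qed
      then show ?thesis
        by (simp add: disjoint_family_on_def)
    qed
    have card_P: "ramsey_number m * 2 ^ ((2 ^ M - 2) * ramsey_number m) \<le> card (P j)"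
      if "j \<in> {1..M}" for j
    proof -
      have "ramsey_number m * 2 ^ ((2 ^ M - 2) * ramsey_number m) + M \<le> k"
        using n_parts_slack[of M "ramsey_number m"] \<open>3 \<le> M\<close> t assms(5) by simp
      moreover have "card (U (\<sigma> j)) = k"
        using assms(8) \<sigma>l[OF that] by blast
      moreover have "card (x ` {1..M}) \<le> M"
        using card_image_le[of "{1..M}" x] by simp
      moreover have "card (U (\<sigma> j)) - card (x ` {1..M}) \<le> card (P j)"
        unfolding P_def by (rule diff_card_le_card_Diff) simp
      ultimately show ?thesis
        by simp
    qed
    have x_P: "x ` {1..M} \<inter> P i = {}" for i
      by (auto simp: P_def)
    have x_V: "x ` {1..M} \<subseteq> V"
      using x(2) \<open>X \<subseteq> V\<close> by blast
    have P_V: "P j \<subseteq> V" if "j \<in> {1..M}" for j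
      using PU UV[OF \<sigma>l[OF that]] by blast
    have "\<exists>xc vc jc. contains_induced V E (U_graph (s, xc, vc, jc) m)"
      by (rule contains_U_graph_of_pattern[OF assms(3,6) x(1) x_V P_V disj_P x_P card_P adj])
    then show ?thesis
      by blast
  qed
qed

end
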